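(* Let $\phi$ be a constant inner function on $\mathbb{D}$ and let $f\in H^2(\mathbb{D})$. Then $\{\phi^n f\}_{n=0}^\infty$ cannot be a frame for $H^2(\mathbb{D})$.
   Context: $\mathbb{D}=\{z\in\mathbb{C}:|z|<1\}$ is the open unit disk and $\mathbb{T}$ the unit circle. $H^\infty(\mathbb{D})$ is the space of bounded holomorphic functions on $\mathbb{D}$. $H^2(\mathbb{D})$ is the Hardy space of holomorphic functions $f(z)=\sum_{n\ge 0}a_nz^n$ on $\mathbb{D}$ with $\|f\|_2^2=\sum_{n\ge0}|a_n|^2<\infty$; it is a Hilbert space with inner product $\langle f,g\rangle=\int_0^{2\pi} f(e^{i\theta})\overline{g(e^{i\theta})}\,\frac{d\theta}{2\pi}$, computed from radial boundary values. A function $\phi\in H^\infty(\mathbb{D})$ is inner if its radial boundary values satisfy $|\phi(e^{i\theta})|=1$ a.e. on $\mathbb{T}$. The sequence $\{\phi^n f\}_{n=0}^\infty\subset H^2(\mathbb{D})$ is a frame for $H^2(\mathbb{D})$ if there exist constants $A,B>0$ such that $A\|g\|_2^2\le\sum_{n=0}^\infty|\langle g,\phi^n f\rangle|^2\le B\|g\|_2^2$ for all $g\in H^2(\mathbb{D})$. *)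

theory Defs
  imports "HOL-Complex_Analysis.Complex_Analysis"
begin

text \<open>
  Functions on the open unit disk are total functions \<open>complex \<Rightarrow> complex\<close>;
  none of the notions below depends on their values outside \<open>ball 0 1\<close>.
\<close>

abbreviation unit_disk :: "complex set" where
  "unit_disk \<equiv> ball 0 1"

text \<open>
  The radial boundary value at \<open>cis \<theta>\<close>, with the convention that it is \<open>0\<close>
  where the radial limit does not exist.  By Fatou's theorem the exceptional angles form a
  null set for the functions considered here, so the convention affects no integral; and since
  the default value does not have modulus 1, \<open>norm (radial_bv \<phi> \<theta>) = 1\<close> entails that
  the radial limit exists.
\<close>
definition radial_bv :: "(complex \<Rightarrow> complex) \<Rightarrow> real \<Rightarrow> complex" where
  "radial_bv f \<theta> =
     (if \<exists>w. ((\<lambda>r. f (of_real r * cis \<theta>)) \<longlongrightarrow> w) (at_left (1::real))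
      then Lim (at_left (1::real)) (\<lambda>r. f (of_real r * cis \<theta>)) else 0)"

definition H_infinity :: "(complex \<Rightarrow> complex) set" where
  "H_infinity = {f. f holomorphic_on unit_disk \<and> bounded (f ` unit_disk)}"

definition inner_function :: "(complex \<Rightarrow> complex) \<Rightarrow> bool" where
  "inner_function \<phi> \<longleftrightarrow>
     \<phi> \<in> H_infinity \<and> (AE \<theta> in lborel. \<theta> \<in> {0..2 * pi} \<longrightarrow> norm (radial_bv \<phi> \<theta>) = 1)"

definition taylor_coeff :: "(complex \<Rightarrow> complex) \<Rightarrow> nat \<Rightarrow> complex" where
  "taylor_coeff f n = (deriv ^^ n) f 0 / fact n"

definition H2 :: "(complex \<Rightarrow> complex) set" where
  "H2 = {f. f holomorphic_on unit_disk \<and> summable (\<lambda>n. (norm (taylor_coeff f n))\<^sup>2)}"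

definition H2_norm :: "(complex \<Rightarrow> complex) \<Rightarrow> real" where
  "H2_norm f = sqrt (\<Sum>n. (norm (taylor_coeff f n))\<^sup>2)"

definition H2_inner :: "(complex \<Rightarrow> complex) \<Rightarrow> (complex \<Rightarrow> complex) \<Rightarrow> complex" where
  "H2_inner f g =
     (LBINT \<theta>:{0..2 * pi}. radial_bv f \<theta> * cnj (radial_bv g \<theta>)) / of_real (2 * pi)"

text \<open>
  The frame inequalities for a sequence \<open>h\<close> of elements of \<open>H2\<close>.  As \<open>suminf\<close> is
  unspecified on divergent series, convergence, which is implicit in the upper frame bound, is
  stated separately.
\<close>
definition H2_frame :: "(nat \<Rightarrow> complex \<Rightarrow> complex) \<Rightarrow> bool" where
  "H2_frame h \<longleftrightarrow>
     (\<exists>A>0. \<exists>B>0. \<forall>g\<in>H2.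
        summable (\<lambda>n. (norm (H2_inner g (h n)))\<^sup>2) \<and>
        A * (H2_norm g)\<^sup>2 \<le> (\<Sum>n. (norm (H2_inner g (h n)))\<^sup>2) \<and>
        (\<Sum>n. (norm (H2_inner g (h n)))\<^sup>2) \<le> B * (H2_norm g)\<^sup>2)"

end

theory Submission
  imports Defs
begin

text \<open>
  A constant inner function is a unimodular number \<open>c\<close>, so the sequence consists of the
  unimodular multiples \<open>c\<^sup>n f\<close> of one function, and
  \<open>\<bar>\<langle>g, c\<^sup>n f\<rangle>\<bar> = \<bar>\<langle>g, f\<rangle>\<bar>\<close> for every \<open>n\<close>.  The upper frame bound makes
  the series with this constant term converge, hence \<open>\<langle>g, f\<rangle> = 0\<close> for every \<open>g\<close>; the lower
  frame bound then forces every \<open>g\<close> to have norm 0, which fails for \<open>g = 1\<close>.  The scalar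
  \<open>c\<^sup>n\<close> comes out of the inner product because radial boundary values are homogeneous and
  depend only on the values in the disk (\<open>radial_bv_cmult\<close>).
\<close>

lemma eventually_radius_in_unit_disk:
  "eventually (\<lambda>r. of_real r * cis \<theta> \<in> unit_disk) (at_left (1::real))"
proof -
  have "eventually (\<lambda>r::real. r \<in> {0<..<1}) (at_left 1)"
    by (rule eventually_at_left_real) simp
  then show ?thesis
    by eventually_elim (simp add: norm_mult)
qed

lemma radial_bv_eqI:
  assumes "((\<lambda>r. f (of_real r * cis \<theta>)) \<longlongrightarrow> w) (at_left (1::real))"
  shows "radial_bv f \<theta> = w"
  using assms tendsto_Lim[OF trivial_limit_at_left_real assms]
  by (auto simp: radial_bv_def)

text \<open>
  For \<open>c \<noteq> 0\<close> the radial limits of \<open>f\<close> and of \<open>c f\<close> exist at the same angles.  Where they do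
  not, both boundary values are 0 by convention, so the identity holds at every angle and
  not just almost everywhere.
\<close>
lemma radial_bv_cmult:
  assumes "c \<noteq> 0" and h: "\<And>z. z \<in> unit_disk \<Longrightarrow> h z = c * f z"
  shows "radial_bv h \<theta> = c * radial_bv f \<theta>"
proof -
  let ?f = "\<lambda>r::real. f (of_real r * cis \<theta>)" and ?h = "\<lambda>r::real. h (of_real r * cis \<theta>)"
  have ev: "eventually (\<lambda>r. ?h r = c * ?f r) (at_left 1)"
    using eventually_radius_in_unit_disk[of \<theta>] by eventually_elim (rule h)
  have lim_iff: "(?h \<longlongrightarrow> c * w) (at_left 1) \<longleftrightarrow> (?f \<longlongrightarrow> w) (at_left 1)" for w
    unfolding tendsto_cong[OF ev] using \<open>c \<noteq> 0\<close> by (rule tendsto_mult_left_iff)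
  show ?thesis
  proof (cases "\<exists>w. (?f \<longlongrightarrow> w) (at_left 1)")
    case True
    then obtain w where "(?f \<longlongrightarrow> w) (at_left 1)" ..
    then show ?thesis
      using lim_iff[of w] by (simp add: radial_bv_eqI)
  next
    case False
    moreover have "\<not> (?h \<longlongrightarrow> w) (at_left 1)" for w
      using False lim_iff[of "w / c"] \<open>c \<noteq> 0\<close> by auto
    ultimately show ?thesis
      by (simp add: radial_bv_def)
  qed
qed

lemma H2_inner_cmult_right:
  assumes "c \<noteq> 0" and "\<And>z. z \<in> unit_disk \<Longrightarrow> h z = c * f z"
  shows "H2_inner g h = cnj c * H2_inner g f"
proof -
  have "radial_bv g \<theta> * cnj (radial_bv h \<theta>) = cnj c * (radial_bv g \<theta> * cnj (radial_bv f \<theta>))" for \<theta>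
    using radial_bv_cmult[of c h f \<theta>] assms by simp
  then show ?thesis
    unfolding H2_inner_def by (simp only: set_integral_mult_right times_divide_eq_right)
qed

lemma inner_function_const_norm:
  assumes "inner_function \<phi>" and \<phi>: "\<And>z. z \<in> unit_disk \<Longrightarrow> \<phi> z = c"
  shows "norm c = 1"
proof (rule ccontr)
  assume "norm c \<noteq> 1"
  have "eventually (\<lambda>r. \<phi> (of_real r * cis \<theta>) = c) (at_left (1::real))" for \<theta>
    using eventually_radius_in_unit_disk[of \<theta>] by eventually_elim (rule \<phi>)
  then have "radial_bv \<phi> \<theta> = c" for \<theta>
    by (intro radial_bv_eqI tendsto_eventually)
  with assms(1) \<open>norm c \<noteq> 1\<close> have "AE \<theta> in lborel. \<theta> \<notin> {0..2 * pi}"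
    by (simp add: inner_function_def)
  then have "emeasure lborel {0..2 * pi} = 0"
    by (subst (asm) AE_iff_measurable[of "{0..2 * pi}"]) auto
  then show False
    by simp
qed

lemma taylor_coeff_one: "taylor_coeff (\<lambda>_. 1) n = (if n = 0 then 1 else 0)"
  by (simp add: taylor_coeff_def)

lemma taylor_coeff_one_sums: "(\<lambda>n. (norm (taylor_coeff (\<lambda>_. 1) n))\<^sup>2) sums 1"
proof -
  have "(norm (taylor_coeff (\<lambda>_. 1) n))\<^sup>2 = (if n = 0 then 1 else 0)" for n
    by (simp add: taylor_coeff_one)
  then show ?thesis
    using sums_single[of 0 "\<lambda>_. 1::real"] by simp
qed

lemma one_in_H2: "(\<lambda>_. 1) \<in> H2"
  using taylor_coeff_one_sums by (auto simp: H2_def sums_iff)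

lemma H2_norm_one: "H2_norm (\<lambda>_. 1) = 1"
  using taylor_coeff_one_sums by (simp add: H2_norm_def sums_iff)

theorem proposition2p4:
  fixes \<phi> f :: "complex \<Rightarrow> complex"
  assumes "inner_function \<phi>"
    and "\<phi> constant_on unit_disk"
    and "f \<in> H2"
  shows "\<not> H2_frame (\<lambda>n z. \<phi> z ^ n * f z)"
proof
  assume "H2_frame (\<lambda>n z. \<phi> z ^ n * f z)"
  then obtain A where "A > 0"
    and summable: "summable (\<lambda>n. (norm (H2_inner (\<lambda>_. 1) (\<lambda>z. \<phi> z ^ n * f z)))\<^sup>2)"
    and lower: "A * (H2_norm (\<lambda>_. 1))\<^sup>2 \<le> (\<Sum>n. (norm (H2_inner (\<lambda>_. 1) (\<lambda>z. \<phi> z ^ n * f z)))\<^sup>2)"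
    unfolding H2_frame_def using one_in_H2 by blast
  obtain c where c: "\<And>z. z \<in> unit_disk \<Longrightarrow> \<phi> z = c"
    using assms(2) by (auto simp: constant_on_def)
  have "norm c = 1"
    using assms(1) c by (rule inner_function_const_norm)
  then have "c \<noteq> 0"
    by auto
  have "H2_inner (\<lambda>_. 1) (\<lambda>z. \<phi> z ^ n * f z) = cnj (c ^ n) * H2_inner (\<lambda>_. 1) f" for n
    using \<open>c \<noteq> 0\<close> by (intro H2_inner_cmult_right) (simp_all add: c)
  then have const: "norm (H2_inner (\<lambda>_. 1) (\<lambda>z. \<phi> z ^ n * f z)) = norm (H2_inner (\<lambda>_. 1) f)" for n
    using \<open>norm c = 1\<close> by (simp add: norm_mult norm_power)
  have "H2_inner (\<lambda>_. 1) f = 0"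
    using summable by (simp add: const summable_const_iff)
  then show False
    using lower \<open>A > 0\<close> by (simp add: const H2_norm_one)
qed

end
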